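(* Let $T$ be a $V$-semiring with respect to the triple $(S,v,M)$, so $T=S_v$. The following statements hold: (1) The set $P_v = \{s\in S_v : v(s) > 0 \}$ is the only maximal ideal of the semiring $S_v$ if and only if $U(S_v) = \{x\in S_v : v(x)=0 \}$. (2) If $v : S \to M_\infty$ is a surjective map, then the semiring $S$ is a semifield if and only if $M$ is an Abelian group and $U(S_v) = \{s\in S_v : v(s)=0 \}$.
   Context: All semirings are commutative, with a zero $0$ (absorbing for multiplication) and an identity $1\neq 0$. A semifield is such a semiring in which every nonzero element is multiplicatively invertible. $U(R)$ denotes the set of units of a semiring $R$. An ideal of a semiring $R$ is a nonempty subset $I$ such that $a,b\in I$ implies $a+b\in I$, and $sa\in I$ for all $s\in R$, $a\in I$; it is proper if $I\neq R$; maximal ideals are the maximal proper ideals. A tomonoid $(M,+,0,\leq)$ is a commutative monoid $(M,+,0)$ with a total order $\leq$ such that $x\leq y$ implies $x+z\leq y+z$ for all $z\in M$. For a tomonoid $M$ with no greatest element, $M_\infty = M\cup\{+\infty\}$ is the tomonoid obtained by adjoining an element $+\infty$ with $m<+\infty$ for all $m\in M$ and $m+(+\infty)=(+\infty)+m=+\infty$ for all $m\in M_\infty$. An $M$-valuation on a semiring $S$ is a map $v:S\to M_\infty$, where $M$ is a tomonoid with no greatest element, such that $v(xy)=v(x)+v(y)$ and $v(x+y)\geq\min\{v(x),v(y)\}$ for all $x,y\in S$, $v(1)=0$ and $v(0)=+\infty$. One sets $S_v=\{s\in S: v(s)\geq 0\}$, which is a subsemiring of $S$. A semiring $T$ is a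 $V$-semiring with respect to the triple $(S,v,M)$ if $v$ is an $M$-valuation on the semiring $S$, $S$ contains $T$ as a subsemiring, and $T=S_v$.
   Formalization: In (2), the direction from "M is an Abelian group and U(S_v) = {v(s)=0}" to "S is a semifield" additionally assumes that v(s)=+∞ only for s=0; without this it is false, e.g. for S=K[e]/(e²), K a discretely valued field, v(a+be)=v_K(a). *)

theory Defs
  imports Main
begin

text \<open>Semirings are the types of class \<^class>\<open>comm_semiring_1\<close> (which includes \<open>0 \<noteq> 1\<close>) and
  their subsemirings, which are sets. The notions below are relative to such a set \<open>R\<close>, so that
  they apply both to the whole type (\<open>R = UNIV\<close>) and to the semiring \<open>S\<^sub>v\<close>.\<close>

definition subsemiring :: "'s::comm_semiring_1 set \<Rightarrow> bool" where
  "subsemiring R \<longleftrightarrow> 0 \<in> R \<and> 1 \<in> R \<and> (\<forall>a\<in>R. \<forall>b\<in>R. a + b \<in> R \<and> a * b \<in> R)"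

definition semiring_units :: "'s::comm_semiring_1 set \<Rightarrow> 's set" where
  "semiring_units R = {u \<in> R. \<exists>w\<in>R. u * w = 1}"

definition semifield_on :: "'s::comm_semiring_1 set \<Rightarrow> bool" where
  "semifield_on R \<longleftrightarrow> (\<forall>s\<in>R. s \<noteq> 0 \<longrightarrow> s \<in> semiring_units R)"

definition semiring_ideal :: "'s::comm_semiring_1 set \<Rightarrow> 's set \<Rightarrow> bool" where
  "semiring_ideal R I \<longleftrightarrow> I \<subseteq> R \<and> I \<noteq> {} \<and>
     (\<forall>a\<in>I. \<forall>b\<in>I. a + b \<in> I) \<and> (\<forall>s\<in>R. \<forall>a\<in>I. s * a \<in> I)"

definition proper_ideal :: "'s::comm_semiring_1 set \<Rightarrow> 's set \<Rightarrow> bool" where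
  "proper_ideal R I \<longleftrightarrow> semiring_ideal R I \<and> I \<noteq> R"

definition maximal_ideal :: "'s::comm_semiring_1 set \<Rightarrow> 's set \<Rightarrow> bool" where
  "maximal_ideal R I \<longleftrightarrow> proper_ideal R I \<and> (\<forall>J. proper_ideal R J \<longrightarrow> I \<subseteq> J \<longrightarrow> J = I)"

class tomonoid = ordered_comm_monoid_add + linorder

text \<open>\<open>'m adj_inf\<close> is \<open>M\<^sub>\<infinity>\<close>. That \<open>M\<close> has no greatest element is expressed, where it is
  required, by the class \<^class>\<open>no_top\<close>.\<close>

datatype 'm adj_inf = Fin 'm | PInf

instantiation adj_inf :: (tomonoid) tomonoid
begin

definition zero_adj_inf :: "'a adj_inf" where
  "0 = Fin 0"

fun plus_adj_inf :: "'a adj_inf \<Rightarrow> 'a adj_inf \<Rightarrow> 'a adj_inf" where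
  "Fin a + Fin b = Fin (a + b)"
| "PInf + y = PInf"
| "x + PInf = PInf"

fun less_eq_adj_inf :: "'a adj_inf \<Rightarrow> 'a adj_inf \<Rightarrow> bool" where
  "Fin a \<le> Fin b \<longleftrightarrow> a \<le> b"
| "x \<le> PInf \<longleftrightarrow> True"
| "PInf \<le> Fin b \<longleftrightarrow> False"

definition less_adj_inf :: "'a adj_inf \<Rightarrow> 'a adj_inf \<Rightarrow> bool" where
  "x < y \<longleftrightarrow> x \<le> y \<and> \<not> y \<le> (x :: 'a adj_inf)"

instance
proof
  fix x y z :: "'a adj_inf"
  show "x + y + z = x + (y + z)"
    by (cases x; cases y; cases z) (auto simp: add.assoc)
  show "x + y = y + x"
    by (cases x; cases y) (auto simp: add.commute)
  show "0 + x = x"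
    by (cases x) (auto simp: zero_adj_inf_def)
  show "x < y \<longleftrightarrow> x \<le> y \<and> \<not> y \<le> x"
    by (rule less_adj_inf_def)
  show "x \<le> x"
    by (cases x) auto
  show "x \<le> z" if "x \<le> y" "y \<le> z"
    using that by (cases x; cases y; cases z) auto
  show "x = y" if "x \<le> y" "y \<le> x"
    using that by (cases x; cases y) auto
  show "z + x \<le> z + y" if "x \<le> y"
    using that by (cases x; cases y; cases z) (auto intro: add_left_mono)
  show "x \<le> y \<or> y \<le> x"
    by (cases x; cases y) auto
qed

end

text \<open>Note that \<open>v s = \<infinity>\<close> is not excluded for \<open>s \<noteq> 0\<close>. If \<open>S\<close> is a semifield, this cannot
  happen, since every nonzero \<open>s\<close> is a unit; so any criterion for \<open>S\<close> to be a semifield has to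
  imply that \<open>v s = \<infinity>\<close> only for \<open>s = 0\<close>.\<close>

definition M_valuation :: "('s::comm_semiring_1 \<Rightarrow> 'm::{tomonoid,no_top} adj_inf) \<Rightarrow> bool" where
  "M_valuation v \<longleftrightarrow>
     (\<forall>x y. v (x * y) = v x + v y) \<and> (\<forall>x y. v (x + y) \<ge> min (v x) (v y)) \<and>
     v 1 = 0 \<and> v 0 = PInf"

definition val_semiring :: "('s::comm_semiring_1 \<Rightarrow> 'm::{tomonoid,no_top} adj_inf) \<Rightarrow> 's set" where
  "val_semiring v = {s. v s \<ge> 0}"

text \<open>The semiring \<open>S\<close> of the triple \<open>(S, v, M)\<close> is the type \<open>'s\<close>, and \<open>M\<close> is the type \<open>'m\<close>.\<close>

definition V_semiring ::
    "'s set \<Rightarrow> ('s::comm_semiring_1 \<Rightarrow> 'm::{tomonoid,no_top} adj_inf) \<Rightarrow> bool" where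
  "V_semiring T v \<longleftrightarrow> M_valuation v \<and> subsemiring T \<and> T = val_semiring v"

end

theory Submission imports Defs begin

text \<open>The engine of both parts is the homomorphism property of \<open>v\<close>. If \<open>u w = 1\<close> inside
  \<open>S\<^sub>v\<close>, then \<open>v u\<close> and \<open>v w\<close> are nonnegative with sum \<open>0\<close>, so both vanish: units of \<open>S\<^sub>v\<close>
  always have value \<open>0\<close>, and the condition on \<open>U(S\<^sub>v)\<close> says that, conversely, every element of
  value \<open>0\<close> is a unit.

  Since \<open>S\<^sub>v\<close> is the disjoint union of the proper ideal \<open>P\<^sub>v\<close> of elements of positive value and the set
  of elements of value \<open>0\<close>, that condition says that \<open>P\<^sub>v\<close> is exactly the set of nonunits. The
  first part is therefore the familiar characterization of local rings: proper ideals consist of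
  nonunits, so \<open>P\<^sub>v\<close> is the largest proper ideal when it contains all of them; and by Zorn's lemma
  every nonunit lies in some maximal ideal, so \<open>P\<^sub>v\<close> contains all nonunits when it is the only one
  (lemma \<open>nonunit_in_maximal_ideal\<close>).

  For the second part, inverses in a semifield map to inverses in \<open>M\<close>, and the inverse of an
  element of value \<open>0\<close> has value \<open>0\<close>, hence stays in \<open>S\<^sub>v\<close>. In the other direction, a nonzero \<open>s\<close>
  has a finite value, because \<open>\<infinity>\<close> is assumed to be attained only at \<open>0\<close>; surjectivity provides \<open>w\<close> with the opposite value, so \<open>s w\<close> has value \<open>0\<close>
  and is invertible, and then so is \<open>s\<close>.\<close>

section \<open>Ideals of subsemirings\<close>

lemma semiring_ideal_proper_iff_one_notin:
  assumes "subsemiring R" "semiring_ideal R I"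
  shows "I \<noteq> R \<longleftrightarrow> 1 \<notin> I"
proof -
  have "R \<subseteq> I" if "1 \<in> I"
  proof
    fix s assume "s \<in> R"
    with that assms(2) have "s * 1 \<in> I"
      unfolding semiring_ideal_def by blast
    then show "s \<in> I" by simp
  qed
  then show ?thesis
    using assms unfolding subsemiring_def semiring_ideal_def by auto
qed

lemma proper_ideal_iff:
  assumes "subsemiring R"
  shows "proper_ideal R I \<longleftrightarrow> semiring_ideal R I \<and> 1 \<notin> I"
  using semiring_ideal_proper_iff_one_notin[OF assms] unfolding proper_ideal_def by blast

lemma proper_ideal_unit_notin:
  assumes "subsemiring R" "proper_ideal R I" "u \<in> semiring_units R"
  shows "u \<notin> I"
proof
  assume "u \<in> I"
  obtain w where "w \<in> R" "u * w = 1"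
    using assms(3) unfolding semiring_units_def by blast
  moreover from this have "w * u \<in> I"
    using \<open>u \<in> I\<close> assms(2) unfolding proper_ideal_def semiring_ideal_def by blast
  ultimately have "1 \<in> I" by (simp add: mult.commute)
  then show False
    using assms(2) proper_ideal_iff[OF assms(1)] by blast
qed

text \<open>Properness amounts to avoiding \<open>1\<close>, so it is inherited by unions of chains.\<close>

lemma proper_ideal_Union_chain:
  assumes "subsemiring R" "C \<noteq> {}" "\<And>J. J \<in> C \<Longrightarrow> proper_ideal R J"
    and chain: "\<And>J K. J \<in> C \<Longrightarrow> K \<in> C \<Longrightarrow> J \<subseteq> K \<or> K \<subseteq> J"
  shows "proper_ideal R (\<Union>C)"
proof -
  have ideal: "semiring_ideal R J" and "1 \<notin> J" if "J \<in> C" for J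
    using that assms(3) proper_ideal_iff[OF assms(1)] by blast+
  have "a + b \<in> \<Union>C" if "a \<in> \<Union>C" "b \<in> \<Union>C" for a b
  proof -
    obtain J K where "J \<in> C" "a \<in> J" "K \<in> C" "b \<in> K"
      using \<open>a \<in> \<Union>C\<close> \<open>b \<in> \<Union>C\<close> by blast
    then obtain L where "L \<in> C" "a \<in> L" "b \<in> L" using chain by blast
    then show ?thesis using ideal unfolding semiring_ideal_def by blast
  qed
  moreover have "\<Union>C \<subseteq> R"
    using ideal unfolding semiring_ideal_def by blast
  moreover have "\<Union>C \<noteq> {}"
    using ideal \<open>C \<noteq> {}\<close> unfolding semiring_ideal_def by fastforce
  moreover have "s * a \<in> \<Union>C" if "s \<in> R" "a \<in> \<Union>C" for s a
    using that ideal unfolding semiring_ideal_def by blast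
  ultimately have "semiring_ideal R (\<Union>C)"
    unfolding semiring_ideal_def by (intro conjI ballI) auto
  then show ?thesis
    using \<open>\<And>J. J \<in> C \<Longrightarrow> 1 \<notin> J\<close> proper_ideal_iff[OF assms(1)] by blast
qed

lemma proper_ideal_subset_maximal_ideal:
  assumes "subsemiring R" "proper_ideal R I"
  obtains J where "maximal_ideal R J" "I \<subseteq> J"
proof -
  let ?A = "{J. proper_ideal R J \<and> I \<subseteq> J}"
  have "\<exists>J\<in>?A. \<forall>K\<in>?A. J \<subseteq> K \<longrightarrow> K = J"
  proof (rule subset_Zorn_nonempty)
    show "?A \<noteq> {}" using assms(2) by blast
  next
    fix C assume "C \<noteq> {}" "subset.chain ?A C"
    then have C: "C \<subseteq> ?A" and chain: "\<And>J K. J \<in> C \<Longrightarrow> K \<in> C \<Longrightarrow> J \<subseteq> K \<or> K \<subseteq> J"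
      unfolding subset_chain_def by blast+
    have "proper_ideal R (\<Union>C)"
      using C by (intro proper_ideal_Union_chain assms(1) \<open>C \<noteq> {}\<close> chain) auto
    then show "\<Union>C \<in> ?A" using C \<open>C \<noteq> {}\<close> by blast
  qed
  then obtain J where J: "proper_ideal R J" "I \<subseteq> J"
      and max: "\<forall>K\<in>?A. J \<subseteq> K \<longrightarrow> K = J"
    by auto
  have "K = J" if "proper_ideal R K" "J \<subseteq> K" for K
    using max that \<open>I \<subseteq> J\<close> by simp
  then have "maximal_ideal R J"
    using J(1) unfolding maximal_ideal_def by simp
  then show thesis using that \<open>I \<subseteq> J\<close> by simp
qed

text \<open>The principal ideal \<open>x R\<close> contains \<open>1\<close> only if \<open>x\<close> is a unit; otherwise it can be enlarged
  to a maximal ideal.\<close>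

lemma nonunit_in_maximal_ideal:
  assumes "subsemiring R" "x \<in> R" "x \<notin> semiring_units R"
  obtains J where "maximal_ideal R J" "x \<in> J"
proof -
  let ?I = "(*) x ` R"
  have R: "1 \<in> R" "\<And>a b. a \<in> R \<Longrightarrow> b \<in> R \<Longrightarrow> a + b \<in> R" "\<And>a b. a \<in> R \<Longrightarrow> b \<in> R \<Longrightarrow> a * b \<in> R"
    using assms(1) unfolding subsemiring_def by blast+
  have "x * a + x * b \<in> ?I" if "a \<in> R" "b \<in> R" for a b
    using R(2)[OF that] by (auto simp flip: distrib_left)
  moreover have "s * (x * a) \<in> ?I" if "s \<in> R" "a \<in> R" for s a
    using R(3)[OF that] by (auto simp: mult.left_commute[of s x])
  moreover have "?I \<subseteq> R" "?I \<noteq> {}" using R assms(2) by auto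
  ultimately have "semiring_ideal R ?I"
    unfolding semiring_ideal_def by simp
  moreover have "1 \<notin> ?I"
    using assms(2,3) unfolding semiring_units_def by auto
  ultimately have "proper_ideal R ?I"
    using proper_ideal_iff[OF assms(1)] by blast
  then obtain J where "maximal_ideal R J" "?I \<subseteq> J"
    using proper_ideal_subset_maximal_ideal[OF assms(1)] by blast
  moreover have "x * 1 \<in> ?I" using R(1) by (rule imageI)
  ultimately show thesis using that by auto
qed

section \<open>Valuations\<close>

lemma adj_inf_add_eq_0D:
  fixes a b :: "'m::tomonoid adj_inf"
  assumes "a + b = 0"
  obtains m n where "a = Fin m" "b = Fin n" "m + n = 0"
  using assms by (cases a; cases b) (auto simp: zero_adj_inf_def)

lemma M_valuation_units:
  assumes "M_valuation v" "u \<in> semiring_units (val_semiring v)"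
  shows "v u = 0"
proof -
  obtain w where "u * w = 1" "0 \<le> v u" "0 \<le> v w"
    using assms(2) unfolding semiring_units_def val_semiring_def by blast
  moreover from this have "v u + v w = 0"
    using assms(1) unfolding M_valuation_def by metis
  ultimately show ?thesis using add_nonneg_eq_0_iff by blast
qed

lemma positive_values_proper_ideal:
  assumes "M_valuation v" "subsemiring (val_semiring v)"
  shows "proper_ideal (val_semiring v) {s \<in> val_semiring v. v s > 0}" (is "proper_ideal ?R ?P")
proof -
  have v: "\<And>x y. v (x * y) = v x + v y" "\<And>x y. min (v x) (v y) \<le> v (x + y)" "v 1 = 0" "v 0 = PInf"
    using assms(1) unfolding M_valuation_def by blast+
  have R: "s \<in> ?R \<longleftrightarrow> 0 \<le> v s" for s
    unfolding val_semiring_def by simp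
  have "a + b \<in> ?P" if "a \<in> ?P" "b \<in> ?P" for a b
  proof -
    have "0 < min (v a) (v b)" using that by simp
    also note v(2)
    finally show ?thesis using R by simp
  qed
  moreover have "s * a \<in> ?P" if "s \<in> ?R" "a \<in> ?P" for s a
  proof -
    have "0 < v s + v a" using that R by (auto intro: add_nonneg_pos)
    then show ?thesis using R v(1) by simp
  qed
  moreover have "0 \<in> ?P" using R v(4) by (simp add: zero_adj_inf_def less_le)
  ultimately have "semiring_ideal ?R ?P" unfolding semiring_ideal_def by blast
  then show ?thesis using proper_ideal_iff[OF assms(2)] v(3) by simp
qed

lemma positive_values_unique_maximal_iff:
  assumes "M_valuation v" "subsemiring (val_semiring v)"
  shows "{I. maximal_ideal (val_semiring v) I} = {{s \<in> val_semiring v. v s > 0}}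
    \<longleftrightarrow> semiring_units (val_semiring v) = {x \<in> val_semiring v. v x = 0}"
    (is "?Max = {?P} \<longleftrightarrow> ?U = ?Z")
proof
  assume "?Max = {?P}"
  have "x \<in> ?U" if "x \<in> ?Z" for x
  proof (rule ccontr)
    assume "x \<notin> ?U"
    then obtain J where "maximal_ideal (val_semiring v) J" "x \<in> J"
      using \<open>x \<in> ?Z\<close> nonunit_in_maximal_ideal[OF assms(2)] by blast
    then have "x \<in> ?P" using \<open>?Max = {?P}\<close> by blast
    with that show False by simp
  qed
  then show "?U = ?Z"
    using M_valuation_units[OF assms(1)] unfolding semiring_units_def by blast
next
  assume "?U = ?Z"
  have P: "proper_ideal (val_semiring v) ?P"
    by (rule positive_values_proper_ideal[OF assms])
  have le: "J \<subseteq> ?P" if "proper_ideal (val_semiring v) J" for J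
  proof
    fix x assume "x \<in> J"
    then have "x \<notin> ?Z" using proper_ideal_unit_notin[OF assms(2) that] \<open>?U = ?Z\<close> by blast
    moreover have "x \<in> val_semiring v"
      using \<open>x \<in> J\<close> that unfolding proper_ideal_def semiring_ideal_def by blast
    ultimately show "x \<in> ?P" unfolding val_semiring_def by auto
  qed
  show "?Max = {?P}"
    using P le unfolding maximal_ideal_def by blast
qed

lemma semifield_values_invertible:
  fixes v :: "'s::comm_semiring_1 \<Rightarrow> 'm::{tomonoid,no_top} adj_inf"
  assumes "M_valuation v" "surj v" "semifield_on (UNIV :: 's set)"
  shows "\<exists>m'. (m::'m) + m' = 0"
proof -
  obtain s where s: "v s = Fin m" using surjD[OF assms(2)] by metis
  then have "s \<noteq> 0" using assms(1) unfolding M_valuation_def by auto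
  then obtain w where "s * w = 1"
    using assms(3) unfolding semifield_on_def semiring_units_def by blast
  then have "v s + v w = 0" using assms(1) unfolding M_valuation_def by metis
  then show ?thesis using s by (auto elim: adj_inf_add_eq_0D)
qed

lemma semifield_units_val_semiring:
  fixes v :: "'s::comm_semiring_1 \<Rightarrow> 'm::{tomonoid,no_top} adj_inf"
  assumes "M_valuation v" "semifield_on (UNIV :: 's set)"
  shows "semiring_units (val_semiring v) = {s \<in> val_semiring v. v s = 0}" (is "?U = ?Z")
proof -
  have "s \<in> ?U" if "s \<in> ?Z" for s
  proof -
    have "s \<noteq> 0" using that assms(1) unfolding M_valuation_def by (auto simp: zero_adj_inf_def)
    then obtain w where "s * w = 1"
      using assms(2) unfolding semifield_on_def semiring_units_def by blast
    moreover from this have "v s + v w = 0" using assms(1) unfolding M_valuation_def by metis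
    then have "w \<in> val_semiring v" using that unfolding val_semiring_def by simp
    ultimately show ?thesis using that unfolding semiring_units_def by blast
  qed
  then show ?thesis
    using M_valuation_units[OF assms(1)] unfolding semiring_units_def by blast
qed

text \<open>Elements of infinite value are never invertible, so \<open>0\<close> has to be the only one. All other
  elements can be moved into the value-\<open>0\<close> part of \<open>S\<^sub>v\<close> by multiplying with an element of
  opposite value.\<close>

lemma semifieldI_valuation:
  fixes v :: "'s::comm_semiring_1 \<Rightarrow> 'm::{tomonoid,no_top} adj_inf"
  assumes "M_valuation v" "surj v" "\<And>s. v s = PInf \<Longrightarrow> s = 0" "\<And>m::'m. \<exists>m'. m + m' = 0"
    and "{s \<in> val_semiring v. v s = 0} \<subseteq> semiring_units (val_semiring v)"
  shows "semifield_on (UNIV :: 's set)"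
proof -
  have "\<exists>w. s * w = 1" if "s \<noteq> 0" for s :: 's
  proof -
    obtain m where m: "v s = Fin m" using \<open>s \<noteq> 0\<close> assms(3) by (cases "v s") auto
    obtain m' where "m + m' = 0" using assms(4) by blast
    moreover obtain w where w: "v w = Fin m'" using surjD[OF assms(2)] by metis
    moreover have "v (s * w) = v s + v w" using assms(1) unfolding M_valuation_def by blast
    ultimately have "v (s * w) = 0" using m by (simp add: zero_adj_inf_def)
    then have "s * w \<in> semiring_units (val_semiring v)"
      using assms(5) unfolding val_semiring_def by auto
    then obtain u where "s * w * u = 1" unfolding semiring_units_def by blast
    then show ?thesis by (metis mult.assoc)
  qed
  then show ?thesis unfolding semifield_on_def semiring_units_def by blast
qed

theorem theorem2p8:
  fixes v :: "'s::comm_semiring_1 \<Rightarrow> 'm::{tomonoid,no_top} adj_inf"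
    and T :: "'s set"
  assumes "V_semiring T v"
  shows "({I. maximal_ideal (val_semiring v) I} = {{s \<in> val_semiring v. v s > 0}}
           \<longleftrightarrow> semiring_units (val_semiring v) = {x \<in> val_semiring v. v x = 0})
       \<and> (surj v \<longrightarrow>
           (semifield_on (UNIV :: 's set)
             \<longrightarrow> (\<forall>m::'m. \<exists>m'. m + m' = 0)
                 \<and> semiring_units (val_semiring v) = {s \<in> val_semiring v. v s = 0})
         \<and> ((\<forall>s. v s = PInf \<longrightarrow> s = 0)
             \<longrightarrow> (\<forall>m::'m. \<exists>m'. m + m' = 0)
                 \<and> semiring_units (val_semiring v) = {s \<in> val_semiring v. v s = 0}
             \<longrightarrow> semifield_on (UNIV :: 's set)))"
proof -
  have v: "M_valuation v" and R: "subsemiring (val_semiring v)"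
    using assms unfolding V_semiring_def by auto
  show ?thesis
  proof (intro conjI impI)
    show "({I. maximal_ideal (val_semiring v) I} = {{s \<in> val_semiring v. v s > 0}})
      = (semiring_units (val_semiring v) = {x \<in> val_semiring v. v x = 0})"
      by (rule positive_values_unique_maximal_iff[OF v R])
  next
    assume "surj v" "semifield_on (UNIV :: 's set)"
    then show "\<forall>m::'m. \<exists>m'. m + m' = 0"
      by (intro allI semifield_values_invertible[OF v])
  next
    assume "semifield_on (UNIV :: 's set)"
    then show "semiring_units (val_semiring v) = {s \<in> val_semiring v. v s = 0}"
      by (rule semifield_units_val_semiring[OF v])
  next
    assume "surj v" "\<forall>s. v s = PInf \<longrightarrow> s = 0"
      "(\<forall>m::'m. \<exists>m'. m + m' = 0)
        \<and> semiring_units (val_semiring v) = {s \<in> val_semiring v. v s = 0}"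
    then show "semifield_on (UNIV :: 's set)"
      using semifieldI_valuation[OF v] by simp
  qed
qed

end
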